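(* Let $\mathbb{K}$ be a field of characteristic zero and $f\in\mathbb{K}[x_1,\ldots,x_n]$ a non-constant polynomial with Bernstein–Sato polynomial $b_f(s)$. Suppose that the left ideal $\operatorname{Ann}_{D_n[s]}(f^s)$ is generated by $h_1,\ldots,h_m$, and let the $1\times(m+1)$ matrix $(a,b_1,\ldots,b_m)$ with entries in $D_n[s]$ be the output of $\textsc{Lift}(\{f,h_1,\ldots,h_m\},\{b_f(s)\})$, i.e. a transformation matrix satisfying $$b_f(s)=a f+\sum_{i=1}^m b_ih_i .$$ Then $P(s)=\operatorname{NF}\big(a,\operatorname{Ann}_{D_n[s]}(f^{s+1})\big)$ is a $B$-operator of $f$.
   Context: $D_n$ is the $n$-th Weyl algebra over $\mathbb{K}$, generated by $x_1,\ldots,x_n,\partial_1,\ldots,\partial_n$ with $\partial_ix_i=x_i\partial_i+1$ and all other pairs of generators commuting; $D_n[s]=D_n\otimes_{\mathbb{K}}\mathbb{K}[s]$ with $s$ a single central variable. $D_n[s]$ acts on the free rank-one $\mathbb{K}[x,s,\frac1f]$-module generated by the formal symbol $f^s$ via $\partial_i\bullet(h f^s)=\left(\frac{\partial h}{\partial x_i}+\frac{s h}{f}\frac{\partial f}{\partial x_i}\right)f^s$, with $x_i$ and $s$ acting by multiplication; $f^{s+1}:=f\cdot f^s$. $\operatorname{Ann}_{D_n[s]}(f^s)$ and $\operatorname{Ann}_{D_n[s]}(f^{s+1})$ are the left ideals of operators in $D_n[s]$ annihilating $f^s$ and $f^{s+1}$, respectively. The Bernstein–Sato polynomial $b_f(s)\in\mathbb{K}[s]$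 is the unique monic polynomial of minimal degree for which there is an operator $P(s)\in D_n[s]$ with $P(s)\bullet f^{s+1}=b_f(s)\cdot f^s$; any operator $P(s)\in D_n[s]$ satisfying this identity is called a $B$-operator of $f$. $\textsc{Lift}(F,H)$ computes a transformation matrix expressing the elements of $H$ as left linear combinations of the elements of $F$, provided the left ideals satisfy $\langle H\rangle\subseteq\langle F\rangle$. $\operatorname{NF}(a,L)$ is the normal form of $a$ with respect to a left Gröbner basis of the left ideal $L$, for a fixed monomial well-ordering on $D_n[s]$; in particular $a-\operatorname{NF}(a,L)\in L$. *)

theory Defs
  imports
    "HOL-Library.Poly_Mapping"
    "HOL-Library.Product_Plus"
    "HOL-Computational_Algebra.Polynomial"
    "HOL-Computational_Algebra.Fraction_Field"
begin

abbreviation (input) "lookup \<equiv> Poly_Mapping.lookup"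
abbreviation (input) "keys \<equiv> Poly_Mapping.keys"

section \<open>Polynomials and rational functions\<close>

text \<open>
  The variables $x_1,\ldots,x_n$ are indexed by a type \<open>'n\<close> of class \<open>{finite, linorder}\<close> with
  $n$ elements (so $n \ge 1$).  \<open>mpoly\<close> is $K[x]$, \<open>xspoly\<close> is $K[x][s]$ with $s$ the variable
  of the outer polynomial ring, and \<open>xsrat\<close> is the field $K(x,s)$, which contains $K[x,s,1/f]$.
\<close>

type_synonym ('n, 'k) mpoly = "('n \<Rightarrow>\<^sub>0 nat) \<Rightarrow>\<^sub>0 'k"
type_synonym ('n, 'k) xspoly = "('n, 'k) mpoly poly"
type_synonym ('n, 'k) xsrat = "('n, 'k) xspoly fract"

definition mconst :: "'k::zero \<Rightarrow> ('n, 'k) mpoly"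
  where "mconst c = Poly_Mapping.single 0 c"

definition mvar :: "'n \<Rightarrow> ('n, 'k::zero_neq_one) mpoly"
  where "mvar i = Poly_Mapping.single (Poly_Mapping.single i 1) 1"

definition mpderiv :: "'n \<Rightarrow> ('n, 'k::comm_ring_1) mpoly \<Rightarrow> ('n, 'k) mpoly"
  where "mpderiv i p = (\<Sum>m\<in>keys p.
    Poly_Mapping.single (m - Poly_Mapping.single i 1) (of_nat (lookup m i) * lookup p m))"

definition xspderiv :: "'n \<Rightarrow> ('n, 'k::comm_ring_1) xspoly \<Rightarrow> ('n, 'k) xspoly"
  where "xspderiv i = map_poly (mpderiv i)"

lemma poly_mapping_sum_single:
  fixes p :: "'a \<Rightarrow>\<^sub>0 'b::comm_monoid_add"
  shows "(\<Sum>m\<in>keys p. Poly_Mapping.single m (lookup p m)) = p"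
  by (rule poly_mapping_eqI)
    (auto simp: lookup_sum lookup_single when_def in_keys_iff sum.If_cases
      intro: sum.neutral)

lemma keys_sum_superset:
  assumes "finite A" "keys p \<subseteq> A" "\<And>m. g m 0 = 0"
  shows "(\<Sum>m\<in>keys p. g m (lookup p m)) = (\<Sum>m\<in>A. g m (lookup p m))"
  using assms by (intro sum.mono_neutral_left) (auto simp: in_keys_iff)

lemma keys_sum_add:
  fixes p q :: "'a \<Rightarrow>\<^sub>0 'b::comm_monoid_add"
  assumes "\<And>m. g m 0 = 0" "\<And>m x y. g m (x + y) = g m x + g m y"
  shows "(\<Sum>m\<in>keys (p + q). g m (lookup (p + q) m))
    = (\<Sum>m\<in>keys p. g m (lookup p m)) + (\<Sum>m\<in>keys q. g m (lookup q m))"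
proof -
  let ?A = "keys p \<union> keys q"
  have "(\<Sum>m\<in>keys (p + q). g m (lookup (p + q) m)) = (\<Sum>m\<in>?A. g m (lookup (p + q) m))"
    by (rule keys_sum_superset) (auto simp: assms keys_add)
  also have "\<dots> = (\<Sum>m\<in>?A. g m (lookup p m)) + (\<Sum>m\<in>?A. g m (lookup q m))"
    by (simp add: lookup_add assms sum.distrib)
  also have "(\<Sum>m\<in>?A. g m (lookup p m)) = (\<Sum>m\<in>keys p. g m (lookup p m))"
    by (rule keys_sum_superset[symmetric]) (auto simp: assms)
  also have "(\<Sum>m\<in>?A. g m (lookup q m)) = (\<Sum>m\<in>keys q. g m (lookup q m))"
    by (rule keys_sum_superset[symmetric]) (auto simp: assms)
  finally show ?thesis .
qed

lemma poly_mapping_add_induct [case_names zero single add]: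
  fixes p :: "'a \<Rightarrow>\<^sub>0 'b::comm_monoid_add"
  assumes "P 0" "\<And>m c. P (Poly_Mapping.single m c)" "\<And>p q. P p \<Longrightarrow> P q \<Longrightarrow> P (p + q)"
  shows "P p"
proof -
  have "P (\<Sum>m\<in>A. Poly_Mapping.single m (lookup p m))" if "finite A" for A
    using that by induction (auto intro: assms)
  from this[of "keys p"] show ?thesis by (simp add: poly_mapping_sum_single)
qed

lemma mpderiv_single:
  "mpderiv i (Poly_Mapping.single m c)
    = Poly_Mapping.single (m - Poly_Mapping.single i 1) (of_nat (lookup m i) * c)"
  by (cases "c = 0") (auto simp: mpderiv_def)

lemma mpderiv_0 [simp]: "mpderiv i 0 = 0"
  by (simp add: mpderiv_def)

lemma mpderiv_add: "mpderiv i (p + q) = mpderiv i p + mpderiv i q"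
  unfolding mpderiv_def by (rule keys_sum_add) (auto simp: ring_distribs single_add)

lemma exponent_minus_add:
  "lookup (m::'n \<Rightarrow>\<^sub>0 nat) i > 0
    \<Longrightarrow> m - Poly_Mapping.single i 1 + m' = m + m' - Poly_Mapping.single i 1"
  by (rule poly_mapping_eqI) (auto simp: lookup_add lookup_minus lookup_single when_def)

lemma mpderiv_mult_single:
  fixes c d :: "'k::comm_ring_1"
  shows "mpderiv i (Poly_Mapping.single m c * Poly_Mapping.single m' d) =
    mpderiv i (Poly_Mapping.single m c) * Poly_Mapping.single m' d
    + Poly_Mapping.single m c * mpderiv i (Poly_Mapping.single m' d)"
proof -
  have 1: "Poly_Mapping.single (m - Poly_Mapping.single i 1 + m') (of_nat (lookup m i) * c * d)
      = Poly_Mapping.single (m + m' - Poly_Mapping.single i 1) (of_nat (lookup m i) * c * d)"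
    using exponent_minus_add[of m i m'] by (cases "lookup m i = 0") simp_all
  have 2: "Poly_Mapping.single (m + (m' - Poly_Mapping.single i 1)) (of_nat (lookup m' i) * c * d)
      = Poly_Mapping.single (m + m' - Poly_Mapping.single i 1) (of_nat (lookup m' i) * c * d)"
    using exponent_minus_add[of m' i m] by (cases "lookup m' i = 0") (simp_all add: add.commute)
  show ?thesis
    using 1 2 by (simp add: mpderiv_single mult_single lookup_add algebra_simps single_add)
qed

lemma mpderiv_mult: "mpderiv i (p * q) = mpderiv i p * q + p * mpderiv i q"
proof (induction p rule: poly_mapping_add_induct)
  case (single m c)
  show ?case
    by (induction q rule: poly_mapping_add_induct)
      (auto simp: mpderiv_mult_single mpderiv_add algebra_simps)
qed (auto simp: mpderiv_add algebra_simps)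

lemma mpderiv_commute: "mpderiv i (mpderiv j p) = mpderiv j (mpderiv i p)"
proof (induction p rule: poly_mapping_add_induct)
  case (single m c)
  have "m - Poly_Mapping.single j 1 - Poly_Mapping.single i 1
      = m - Poly_Mapping.single i 1 - Poly_Mapping.single j (1::nat)"
    by (rule poly_mapping_eqI) (simp add: lookup_minus)
  then show ?case
    by (cases "i = j") (auto simp: mpderiv_single lookup_minus lookup_single algebra_simps)
qed (auto simp: mpderiv_add)

lemma coeff_xspderiv: "coeff (xspderiv i p) k = mpderiv i (coeff p k)"
  by (simp add: xspderiv_def coeff_map_poly)

lemma mpderiv_sum: "mpderiv i (sum g A) = (\<Sum>a\<in>A. mpderiv i (g a))"
  by (induction A rule: infinite_finite_induct) (auto simp: mpderiv_add)

lemma xspderiv_0 [simp]: "xspderiv i 0 = 0"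
  by (rule poly_eqI) (simp add: coeff_xspderiv)

lemma xspderiv_add: "xspderiv i (p + q) = xspderiv i p + xspderiv i q"
  by (rule poly_eqI) (simp add: coeff_xspderiv mpderiv_add)

lemma xspderiv_mult: "xspderiv i (p * q) = xspderiv i p * q + p * xspderiv i q"
  by (rule poly_eqI)
    (simp add: coeff_xspderiv coeff_mult mpderiv_sum mpderiv_mult sum.distrib)

lemma xspderiv_commute: "xspderiv i (xspderiv j p) = xspderiv j (xspderiv i p)"
  by (rule poly_eqI) (simp add: coeff_xspderiv mpderiv_commute[of i j])

lift_definition rat_pderiv ::
    "'n::linorder \<Rightarrow> ('n, 'k::field) xsrat \<Rightarrow> ('n, 'k) xsrat"
  is "\<lambda>i q. (xspderiv i (fst q) * snd q - fst q * xspderiv i (snd q), snd q * snd q)"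
proof -
  fix i :: 'n and q r :: "('n, 'k) xspoly \<times> ('n, 'k) xspoly"
  assume a: "fractrel q r"
  obtain a b c d where qr: "q = (a, b)" "r = (c, d)"
    by (metis surj_pair)
  have nz: "b \<noteq> 0" "d \<noteq> 0" and e: "a * d = c * b"
    using a qr by auto
  let ?D = "xspderiv i"
  have e': "?D a * d + a * ?D d = ?D c * b + c * ?D b"
    using arg_cong[OF e, of ?D] by (simp add: xspderiv_mult)
  have "(?D a * b - a * ?D b) * (d * d) = (?D c * d - c * ?D d) * (b * b)"
    using e e' by algebra
  then show "fractrel (?D (fst q) * snd q - fst q * ?D (snd q), snd q * snd q)
      (?D (fst r) * snd r - fst r * ?D (snd r), snd r * snd r)"
    using nz qr by simp
qed

definition rat_of_xs :: "('n::linorder, 'k::field) xspoly \<Rightarrow> ('n, 'k) xsrat"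
  where "rat_of_xs p = Fract p 1"

definition rat_of_x :: "('n::linorder, 'k::field) mpoly \<Rightarrow> ('n, 'k) xsrat"
  where "rat_of_x p = rat_of_xs [:p:]"

definition rat_of_s :: "'k::field poly \<Rightarrow> ('n::linorder, 'k) xsrat"
  where "rat_of_s b = rat_of_xs (map_poly mconst b)"

definition rat_s :: "('n::linorder, 'k::field) xsrat"
  where "rat_s = rat_of_xs [:0, 1:]"

lemma rat_pderiv_Fract:
  "b \<noteq> 0 \<Longrightarrow> rat_pderiv i (Fract a b) = Fract (xspderiv i a * b - a * xspderiv i b) (b * b)"
  by transfer simp

lemma rat_pderiv_add: "rat_pderiv i (p + q) = rat_pderiv i p + rat_pderiv i q"
  by (cases p; cases q)
    (simp add: rat_pderiv_Fract xspderiv_mult xspderiv_add eq_fract algebra_simps)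

lemma rat_pderiv_mult: "rat_pderiv i (p * q) = rat_pderiv i p * q + p * rat_pderiv i q"
  by (cases p; cases q)
    (simp add: rat_pderiv_Fract xspderiv_mult xspderiv_add eq_fract algebra_simps)

lemma rat_pderiv_0 [simp]: "rat_pderiv i 0 = 0"
  by (simp add: Zero_fract_def rat_pderiv_Fract eq_fract)

lemma xspderiv_1 [simp]: "xspderiv i 1 = 0"
  using xspderiv_mult[of i 1 1] by simp

lemma rat_pderiv_of_xs: "rat_pderiv i (rat_of_xs p) = rat_of_xs (xspderiv i p)"
  by (simp add: rat_of_xs_def rat_pderiv_Fract)

lemma rat_of_xs_0 [simp]: "rat_of_xs 0 = 0"
  and rat_of_xs_1 [simp]: "rat_of_xs 1 = 1"
  and rat_of_xs_add: "rat_of_xs (p + q) = rat_of_xs p + rat_of_xs q"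
  and rat_of_xs_mult: "rat_of_xs (p * q) = rat_of_xs p * rat_of_xs q"
  by (simp_all add: rat_of_xs_def Zero_fract_def One_fract_def)

lemma rat_of_xs_eq_0_iff [simp]: "rat_of_xs p = 0 \<longleftrightarrow> p = 0"
  by (simp add: rat_of_xs_def Zero_fract_def eq_fract)

lemma rat_pderiv_commute: "rat_pderiv i (rat_pderiv j h) = rat_pderiv j (rat_pderiv i h)"
proof (cases h)
  case (Fract a b)
  let ?A = "rat_of_xs a" and ?B = "rat_of_xs b"
  have A: "?A = h * ?B" and B: "?B \<noteq> 0"
    using Fract by (simp_all add: rat_of_xs_def eq_fract Zero_fract_def)
  have c: "rat_pderiv i (rat_pderiv j (rat_of_xs p)) = rat_pderiv j (rat_pderiv i (rat_of_xs p))"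
    for p :: "('a, 'b) xspoly"
    by (simp add: rat_pderiv_of_xs xspderiv_commute[of i j])
  have "rat_pderiv i (rat_pderiv j (h * ?B)) = rat_pderiv j (rat_pderiv i (h * ?B))"
    using c[of a] A by simp
  then have "rat_pderiv i (rat_pderiv j h) * ?B = rat_pderiv j (rat_pderiv i h) * ?B"
    using c[of b] by (simp add: rat_pderiv_mult rat_pderiv_add algebra_simps)
  with B show ?thesis by simp
qed

section \<open>The Weyl algebra by generators and relations\<close>

datatype 'g free_monoid = Word (letters: "'g list")

instantiation free_monoid :: (type) monoid_add
begin
definition zero_free_monoid where "0 = Word []"
definition plus_free_monoid where "u + v = Word (letters u @ letters v)"
instance
  by intro_classes (auto simp: zero_free_monoid_def plus_free_monoid_def)
end

datatype 'n weyl_gen = GX 'n | GD 'n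

text \<open>The free associative algebra is the monoid algebra of the free monoid.\<close>

type_synonym ('n, 'k) free_weyl = "'n weyl_gen free_monoid \<Rightarrow>\<^sub>0 'k"

definition free_gen :: "'n weyl_gen \<Rightarrow> ('n, 'k::zero_neq_one) free_weyl"
  where "free_gen g = Poly_Mapping.single (Word [g]) 1"

definition is_left_ideal :: "'a::ring_1 set \<Rightarrow> bool"
  where "is_left_ideal I \<longleftrightarrow> 0 \<in> I \<and> (\<forall>a\<in>I. \<forall>b\<in>I. a + b \<in> I) \<and> (\<forall>a\<in>I. \<forall>r. r * a \<in> I)"

definition is_two_sided_ideal :: "'a::ring_1 set \<Rightarrow> bool"
  where "is_two_sided_ideal I \<longleftrightarrow> is_left_ideal I \<and> (\<forall>a\<in>I. \<forall>r. a * r \<in> I)"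

definition weyl_relators :: "('n, 'k::comm_ring_1) free_weyl set"
  where "weyl_relators =
    {free_gen (GD i) * free_gen (GX i) - free_gen (GX i) * free_gen (GD i) - 1 | i. True}
    \<union> {free_gen (GD i) * free_gen (GX j) - free_gen (GX j) * free_gen (GD i) | i j. i \<noteq> j}
    \<union> {free_gen (GX i) * free_gen (GX j) - free_gen (GX j) * free_gen (GX i) | i j. True}
    \<union> {free_gen (GD i) * free_gen (GD j) - free_gen (GD j) * free_gen (GD i) | i j. True}"

definition weyl_ideal :: "('n, 'k::comm_ring_1) free_weyl set"
  where "weyl_ideal = is_two_sided_ideal hull weyl_relators"

text \<open>
  The action on $K(x,s) f^s$, first for the free algebra.  An element $h f^s$ is represented by
  its coefficient $h$; in particular $f^s$ is \<open>1\<close> and $f^{s+1}$ is $f$.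
\<close>

fun gen_act :: "('n::linorder, 'k::field) mpoly \<Rightarrow> 'n weyl_gen \<Rightarrow> ('n, 'k) xsrat \<Rightarrow> ('n, 'k) xsrat"
  where
    "gen_act f (GX i) h = rat_of_x (mvar i) * h"
  | "gen_act f (GD i) h = rat_pderiv i h + rat_s * h / rat_of_x f * rat_of_x (mpderiv i f)"

definition word_act ::
    "('n::linorder, 'k::field) mpoly \<Rightarrow> 'n weyl_gen free_monoid \<Rightarrow> ('n, 'k) xsrat \<Rightarrow> ('n, 'k) xsrat"
  where "word_act f w h = foldr (gen_act f) (letters w) h"

definition free_act ::
    "('n::linorder, 'k::field) mpoly \<Rightarrow> ('n, 'k) free_weyl \<Rightarrow> ('n, 'k) xsrat \<Rightarrow> ('n, 'k) xsrat"
  where "free_act f p h = (\<Sum>w\<in>keys p. rat_of_x (mconst (lookup p w)) * word_act f w h)"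

lemma rat_of_x_0 [simp]: "rat_of_x 0 = 0"
  and rat_of_x_1 [simp]: "rat_of_x 1 = 1"
  and rat_of_x_add: "rat_of_x (p + q) = rat_of_x p + rat_of_x q"
  and rat_of_x_mult: "rat_of_x (p * q) = rat_of_x p * rat_of_x q"
  by (simp_all add: rat_of_x_def rat_of_xs_add[symmetric] rat_of_xs_mult[symmetric] mult.commute
      flip: one_pCons)

lemma rat_of_x_eq_0_iff [simp]: "rat_of_x p = 0 \<longleftrightarrow> p = 0"
  by (simp add: rat_of_x_def)

lemma mconst_0 [simp]: "mconst 0 = 0"
  and mconst_1 [simp]: "mconst 1 = 1"
  and mconst_add: "mconst (a + b) = mconst a + mconst b"
  and mconst_mult: "mconst (x * y) = mconst x * mconst y"
  for a b :: "'k::comm_monoid_add" and x y :: "'r::comm_ring_1"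
  by (simp_all add: mconst_def single_add mult_single)

lemma rat_pderiv_x: "rat_pderiv i (rat_of_x p) = rat_of_x (mpderiv i p)"
  by (simp add: rat_of_x_def rat_pderiv_of_xs xspderiv_def map_poly_pCons)

lemma mpderiv_const [simp]: "mpderiv i (mconst c) = 0"
  by (simp add: mconst_def mpderiv_single)

lemma mpderiv_1 [simp]: "mpderiv i 1 = 0"
  using mpderiv_const[of i 1] by simp

lemma mpderiv_var: "mpderiv i (mvar j) = (if i = j then 1 else 0)"
  by (auto simp: mvar_def mpderiv_single lookup_single)

lemma rat_pderiv_s [simp]: "rat_pderiv i rat_s = 0"
  by (simp add: rat_s_def rat_pderiv_of_xs xspderiv_def map_poly_pCons)

abbreviation rat_c :: "'k::field \<Rightarrow> ('n::linorder, 'k) xsrat"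
  where "rat_c c \<equiv> rat_of_x (mconst c)"

lemma gen_act_0 [simp]: "gen_act f g 0 = 0"
  and gen_act_add: "gen_act f g (h + h') = gen_act f g h + gen_act f g h'"
  and gen_act_const: "gen_act f g (rat_c c * h) = rat_c c * gen_act f g h"
  by (cases g; simp add: rat_pderiv_add rat_pderiv_mult rat_pderiv_x field_simps add_divide_distrib)+

lemma word_act_0 [simp]: "word_act f w 0 = 0"
  and word_act_add: "word_act f w (h + h') = word_act f w h + word_act f w h'"
  and word_act_const: "word_act f w (rat_c c * h) = rat_c c * word_act f w h"
proof -
  have "foldr (gen_act f) l 0 = 0"
    "foldr (gen_act f) l (h + h') = foldr (gen_act f) l h + foldr (gen_act f) l h'"
    "foldr (gen_act f) l (rat_c c * h) = rat_c c * foldr (gen_act f) l h" for l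
    by (induction l) (auto simp: gen_act_add gen_act_const)
  then show "word_act f w 0 = 0" "word_act f w (h + h') = word_act f w h + word_act f w h'"
    "word_act f w (rat_c c * h) = rat_c c * word_act f w h"
    by (simp_all add: word_act_def)
qed

lemma free_act_add: "free_act f (p + q) h = free_act f p h + free_act f q h"
  unfolding free_act_def
  by (rule keys_sum_add) (auto simp: mconst_add rat_of_x_add algebra_simps)

lemma free_act_0 [simp]: "free_act f 0 h = 0"
  by (simp add: free_act_def)

lemma free_act_uminus: "free_act f (- p) h = - free_act f p h"
  using free_act_add[of f p "- p" h] by (simp add: eq_neg_iff_add_eq_0 add.commute)

lemma free_act_diff: "free_act f (p - q) h = free_act f p h - free_act f q h"
  using free_act_add[of f p "- q" h] by (simp add: free_act_uminus)

lemma free_act_single: "free_act f (Poly_Mapping.single w c) h = rat_c c * word_act f w h"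
  by (cases "c = 0") (auto simp: free_act_def)

lemma free_act_gen: "free_act f (free_gen g) h = gen_act f g h"
  by (simp add: free_gen_def free_act_single word_act_def)

lemma free_act_1: "free_act f 1 h = h"
proof -
  have "word_act f 0 h = h" by (simp add: word_act_def zero_free_monoid_def)
  then show ?thesis using free_act_single[of f 0 1 h] by simp
qed

lemma free_act_right_add: "free_act f p (h + h') = free_act f p h + free_act f p h'"
  by (simp add: free_act_def word_act_add distrib_left sum.distrib)

lemma free_act_right_0 [simp]: "free_act f p 0 = 0"
  by (simp add: free_act_def)

lemma free_act_right_const: "free_act f p (rat_c c * h) = rat_c c * free_act f p h"
  by (simp add: free_act_def word_act_const sum_distrib_left mult.left_commute)

lemma word_act_plus: "word_act f (v + w) h = word_act f v (word_act f w h)"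
  by (simp add: word_act_def plus_free_monoid_def)

lemma free_act_mult: "free_act f (p * q) h = free_act f p (free_act f q h)"
proof (induction p rule: poly_mapping_add_induct)
  case (single w c)
  show ?case
    by (induction q rule: poly_mapping_add_induct)
      (auto simp: distrib_left free_act_add free_act_right_add mult_single free_act_single
        mconst_mult rat_of_x_mult word_act_const word_act_plus word_act_add)
qed (auto simp: distrib_right free_act_add)

lemma gen_act_relations:
  "gen_act f (GD i) (gen_act f (GX j) h)
    = gen_act f (GX j) (gen_act f (GD i) h) + (if i = j then h else 0)"
  "gen_act f (GX i) (gen_act f (GX j) h) = gen_act f (GX j) (gen_act f (GX i) h)"
  "gen_act f (GD i) (gen_act f (GD j) h) = gen_act f (GD j) (gen_act f (GD i) h)"
proof -
  show "gen_act f (GD i) (gen_act f (GX j) h)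
    = gen_act f (GX j) (gen_act f (GD i) h) + (if i = j then h else 0)"
    by (simp add: rat_pderiv_mult rat_pderiv_x mpderiv_var algebra_simps)
  show "gen_act f (GX i) (gen_act f (GX j) h) = gen_act f (GX j) (gen_act f (GX i) h)"
    by simp
  show "gen_act f (GD i) (gen_act f (GD j) h) = gen_act f (GD j) (gen_act f (GD i) h)"
  proof (cases "f = 0")
    case True
    then show ?thesis by (simp add: rat_pderiv_commute[of i j])
  next
    case False
    define F where "F = rat_of_x f"
    define u where "u = (\<lambda>k. rat_s / F * rat_of_x (mpderiv k f))"
    have F: "F \<noteq> 0" using False by (simp add: F_def)
    have uF: "u k * F = rat_s * rat_of_x (mpderiv k f)" for k
      using F by (simp add: u_def)
    have "rat_pderiv l (u k) * F + u k * rat_of_x (mpderiv l f)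
        = rat_s * rat_of_x (mpderiv l (mpderiv k f))" for k l
      using arg_cong[OF uF[of k], of "rat_pderiv l"]
      by (simp add: rat_pderiv_mult F_def rat_pderiv_x)
    from this[of i j] this[of j i]
    have "rat_pderiv i (u j) * F + u j * rat_of_x (mpderiv i f)
        = rat_pderiv j (u i) * F + u i * rat_of_x (mpderiv j f)"
      by (simp add: mpderiv_commute[of i j])
    moreover have "u j * rat_of_x (mpderiv i f) = u i * rat_of_x (mpderiv j f)"
      by (simp add: u_def)
    ultimately have "rat_pderiv i (u j) * F = rat_pderiv j (u i) * F"
      by simp
    then have sym: "rat_pderiv i (u j) = rat_pderiv j (u i)" using F by simp
    have g: "gen_act f (GD k) h = rat_pderiv k h + u k * h" for k h
      by (simp add: u_def F_def)
    show ?thesis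
      by (simp add: g rat_pderiv_add rat_pderiv_mult sym rat_pderiv_commute[of i j] algebra_simps
          del: gen_act.simps)
  qed
qed

lemma free_act_weyl_ideal:
  assumes "p \<in> weyl_ideal"
  shows "free_act f p h = 0"
proof -
  let ?I = "{p. \<forall>h. free_act f p h = 0}"
  have "is_two_sided_ideal ?I"
    by (simp add: is_two_sided_ideal_def is_left_ideal_def free_act_add free_act_mult)
  moreover have "weyl_relators \<subseteq> ?I"
    unfolding weyl_relators_def
    by (auto simp: free_act_diff free_act_mult free_act_gen free_act_1 gen_act_relations
        simp del: gen_act.simps)
  ultimately have "weyl_ideal \<subseteq> ?I"
    unfolding weyl_ideal_def by (intro hull_minimal)
  with assms show ?thesis by auto
qed

lemma weyl_ideal_two_sided: "is_two_sided_ideal weyl_ideal"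
  unfolding weyl_ideal_def
  by (rule hull_in) (auto simp: is_two_sided_ideal_def is_left_ideal_def)

lemma weyl_ideal_0: "0 \<in> weyl_ideal"
  and weyl_ideal_add: "p \<in> weyl_ideal \<Longrightarrow> q \<in> weyl_ideal \<Longrightarrow> p + q \<in> weyl_ideal"
  and weyl_ideal_left: "p \<in> weyl_ideal \<Longrightarrow> r * p \<in> weyl_ideal"
  and weyl_ideal_right: "p \<in> weyl_ideal \<Longrightarrow> p * r \<in> weyl_ideal"
  using weyl_ideal_two_sided by (auto simp: is_two_sided_ideal_def is_left_ideal_def)

lemma weyl_ideal_uminus: "p \<in> weyl_ideal \<Longrightarrow> - p \<in> weyl_ideal"
  using weyl_ideal_left[of p "- 1"] by simp

definition weyl_cong :: "('n, 'k::comm_ring_1) free_weyl \<Rightarrow> ('n, 'k) free_weyl \<Rightarrow> bool"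
  where "weyl_cong p q \<longleftrightarrow> p - q \<in> weyl_ideal"

quotient_type (overloaded) ('n, 'k) weyl = "('n, 'k::comm_ring_1) free_weyl" / weyl_cong
proof (rule equivpI)
  show "reflp weyl_cong" by (auto simp: reflp_def weyl_cong_def weyl_ideal_0)
  show "symp weyl_cong"
    unfolding symp_def weyl_cong_def by (metis minus_diff_eq weyl_ideal_uminus)
  show "transp weyl_cong"
    unfolding transp_def weyl_cong_def
    by (metis (no_types, lifting) add_diff_eq diff_add_cancel weyl_ideal_add)
qed

instantiation weyl :: (linorder, field) ring_1
begin

lift_definition zero_weyl :: "('a, 'b) weyl" is 0 .
lift_definition one_weyl :: "('a, 'b) weyl" is 1 .
lift_definition plus_weyl :: "('a, 'b) weyl \<Rightarrow> ('a, 'b) weyl \<Rightarrow> ('a, 'b) weyl" is "(+)"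
  unfolding weyl_cong_def by (metis add_diff_add weyl_ideal_add)
lift_definition uminus_weyl :: "('a, 'b) weyl \<Rightarrow> ('a, 'b) weyl" is uminus
  unfolding weyl_cong_def
  by (metis minus_diff_minus weyl_ideal_uminus)
lift_definition minus_weyl :: "('a, 'b) weyl \<Rightarrow> ('a, 'b) weyl \<Rightarrow> ('a, 'b) weyl" is "(-)"
proof -
  fix p p' q q' :: "('a, 'b) free_weyl"
  assume "weyl_cong p p'" "weyl_cong q q'"
  then have "(p - p') + - (q - q') \<in> weyl_ideal"
    unfolding weyl_cong_def by (intro weyl_ideal_add weyl_ideal_uminus)
  then show "weyl_cong (p - q) (p' - q')" by (simp add: weyl_cong_def algebra_simps)
qed
lift_definition times_weyl :: "('a, 'b) weyl \<Rightarrow> ('a, 'b) weyl \<Rightarrow> ('a, 'b) weyl" is "(*)"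
proof -
  fix p p' q q' :: "('a, 'b) free_weyl"
  assume "weyl_cong p p'" "weyl_cong q q'"
  then have "(p - p') * q + p' * (q - q') \<in> weyl_ideal"
    unfolding weyl_cong_def by (intro weyl_ideal_add weyl_ideal_left weyl_ideal_right)
  then show "weyl_cong (p * q) (p' * q')" by (simp add: weyl_cong_def algebra_simps)
qed

instance
proof
  fix a b c :: "('a, 'b) weyl"
  have r: "weyl_cong x x" for x :: "('a, 'b) free_weyl"
    by (simp add: weyl_cong_def weyl_ideal_0)
  show "a + b + c = a + (b + c)" by transfer (simp add: r add.assoc)
  show "a + b = b + a" by transfer (simp add: r add.commute)
  show "0 + a = a" by transfer (simp add: r)
  show "- a + a = 0" by transfer (simp add: r)
  show "a - b = a + - b" by transfer (simp add: r)
  show "a * b * c = a * (b * c)" by transfer (simp add: r mult.assoc)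
  show "1 * a = a" by transfer (simp add: r)
  show "a * 1 = a" by transfer (simp add: r)
  show "(a + b) * c = a * c + b * c" by transfer (simp add: r distrib_right)
  show "a * (b + c) = a * b + a * c" by transfer (simp add: r distrib_left)
  show "(0::('a, 'b) weyl) \<noteq> 1"
  proof transfer
    show "\<not> weyl_cong (0::('a, 'b) free_weyl) 1"
    proof
      assume "weyl_cong (0::('a, 'b) free_weyl) 1"
      then have "(1::('a, 'b) free_weyl) \<in> weyl_ideal"
        unfolding weyl_cong_def using weyl_ideal_uminus by fastforce
      from free_act_weyl_ideal[OF this, of 1 1] show False by (simp add: free_act_1)
    qed
  qed
qed

end

lift_definition weyl_x :: "'n::linorder \<Rightarrow> ('n, 'k::field) weyl" is "\<lambda>i. free_gen (GX i)" .
lift_definition weyl_d :: "'n::linorder \<Rightarrow> ('n, 'k::field) weyl" is "\<lambda>i. free_gen (GD i)" .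
lift_definition weyl_const :: "'k::field \<Rightarrow> ('n::linorder, 'k) weyl"
  is "\<lambda>c. Poly_Mapping.single 0 c" .

lift_definition weyl_act ::
    "('n::linorder, 'k::field) mpoly \<Rightarrow> ('n, 'k) weyl \<Rightarrow> ('n, 'k) xsrat \<Rightarrow> ('n, 'k) xsrat"
  is free_act
  unfolding weyl_cong_def
  by (metis ext eq_iff_diff_eq_0 free_act_diff free_act_weyl_ideal)

section \<open>The algebra $D_n[s]$ and its action\<close>

text \<open>$D_n \otimes_K K[s]$ is the monoid algebra of \<open>nat\<close> over $D_n$: \<open>single k a\<close> is $a s^k$.\<close>

type_synonym ('n, 'k) weyl_s = "nat \<Rightarrow>\<^sub>0 ('n, 'k) weyl"

definition ws_const :: "'k::field \<Rightarrow> ('n::linorder, 'k) weyl_s"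
  where "ws_const c = Poly_Mapping.single 0 (weyl_const c)"

definition weyl_monom :: "('n::{finite,linorder} \<Rightarrow>\<^sub>0 nat) \<Rightarrow> ('n \<Rightarrow>\<^sub>0 nat) \<Rightarrow> ('n, 'k::field) weyl"
  where "weyl_monom \<alpha> \<beta> =
    prod_list (map (\<lambda>i. weyl_x i ^ lookup \<alpha> i) (sorted_list_of_set UNIV))
    * prod_list (map (\<lambda>i. weyl_d i ^ lookup \<beta> i) (sorted_list_of_set UNIV))"

definition ws_of_x :: "('n::{finite,linorder}, 'k::field) mpoly \<Rightarrow> ('n, 'k) weyl_s"
  where "ws_of_x p =
    (\<Sum>m\<in>keys p. Poly_Mapping.single 0 (weyl_const (lookup p m) * weyl_monom m 0))"

definition ws_of_s :: "'k::field poly \<Rightarrow> ('n::linorder, 'k) weyl_s"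
  where "ws_of_s b = (\<Sum>k\<le>degree b. Poly_Mapping.single k (weyl_const (coeff b k)))"

definition ws_act ::
    "('n::linorder, 'k::field) mpoly \<Rightarrow> ('n, 'k) weyl_s \<Rightarrow> ('n, 'k) xsrat \<Rightarrow> ('n, 'k) xsrat"
  where "ws_act f P h = (\<Sum>k\<in>keys P. rat_s ^ k * weyl_act f (lookup P k) h)"

text \<open>
  The module $K[x,s,1/f] f^s$ consists of the $h f^s$ with \<open>h \<in> fs_module f\<close>; it contains $f^s$ and
  $f^{s+1}$ and is stable under the action.
\<close>

definition fs_module :: "('n::linorder, 'k::field) mpoly \<Rightarrow> ('n, 'k) xsrat set"
  where "fs_module f = {rat_of_xs p / rat_of_x f ^ k | p k. True}"

definition fpow_s :: "('n::linorder, 'k::field) xsrat"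
  where "fpow_s = 1"

definition fpow_s1 :: "('n::linorder, 'k::field) mpoly \<Rightarrow> ('n, 'k) xsrat"
  where "fpow_s1 f = rat_of_x f * fpow_s"

lemma fs_module_of_xs: "rat_of_xs p \<in> fs_module f"
  unfolding fs_module_def mem_Collect_eq by (rule exI[of _ p], rule exI[of _ 0]) simp

lemma fs_module_mult: "h \<in> fs_module f \<Longrightarrow> h' \<in> fs_module f \<Longrightarrow> h * h' \<in> fs_module f"
proof -
  assume "h \<in> fs_module f" "h' \<in> fs_module f"
  then obtain p k q l where "h = rat_of_xs p / rat_of_x f ^ k" "h' = rat_of_xs q / rat_of_x f ^ l"
    unfolding fs_module_def by auto
  then have "h * h' = rat_of_xs (p * q) / rat_of_x f ^ (k + l)"
    by (simp add: rat_of_xs_mult power_add)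
  then show ?thesis unfolding fs_module_def by blast
qed

lemma fs_module_inverse: "1 / rat_of_x f \<in> fs_module f"
  unfolding fs_module_def mem_Collect_eq by (rule exI[of _ 1], rule exI[of _ 1]) simp

lemma rat_of_xs_power: "rat_of_xs p ^ k = rat_of_xs (p ^ k)"
  by (induction k) (auto simp: rat_of_xs_mult)

lemma fs_module_add:
  assumes "f \<noteq> 0" "h \<in> fs_module f" "h' \<in> fs_module f"
  shows "h + h' \<in> fs_module f"
proof -
  from assms obtain p k q l
    where e: "h = rat_of_xs p / rat_of_x f ^ k" "h' = rat_of_xs q / rat_of_x f ^ l"
    unfolding fs_module_def by auto
  have "h + h' = rat_of_xs (p * [:f:] ^ l + q * [:f:] ^ k) / rat_of_x f ^ (k + l)"
    using assms(1) unfolding e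
    by (simp add: rat_of_xs_mult rat_of_xs_add power_add field_simps
        flip: rat_of_xs_power rat_of_x_def)
  then show ?thesis unfolding fs_module_def by blast
qed

lemma fs_module_sum:
  "f \<noteq> 0 \<Longrightarrow> (\<And>a. a \<in> A \<Longrightarrow> g a \<in> fs_module f) \<Longrightarrow> sum g A \<in> fs_module f"
  using fs_module_of_xs[of 0 f]
  by (induction A rule: infinite_finite_induct) (auto intro: fs_module_add)

lemma fs_module_pderiv:
  assumes "f \<noteq> 0" "h \<in> fs_module f"
  shows "rat_pderiv i h \<in> fs_module f"
proof -
  let ?F = "rat_of_x f"
  have F: "?F \<noteq> 0" using assms by simp
  from assms obtain p k where e: "h = rat_of_xs p / ?F ^ k"
    unfolding fs_module_def by auto
  let ?q = "[:f:] ^ k"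
  have q: "?F ^ k = rat_of_xs ?q" by (simp add: rat_of_x_def rat_of_xs_power)
  have "rat_pderiv i (h * ?F ^ k) = rat_of_xs (xspderiv i p)"
    using F by (simp add: e rat_pderiv_of_xs)
  then have "rat_pderiv i h * ?F ^ k = rat_of_xs (xspderiv i p) + rat_of_xs (- 1) * (h * rat_of_xs (xspderiv i ?q))"
    unfolding q by (simp add: rat_pderiv_mult rat_pderiv_of_xs rat_of_xs_def[of "- 1"]
        algebra_simps flip: One_fract_def minus_fract)
  then have "rat_pderiv i h = (rat_of_xs (xspderiv i p) + rat_of_xs (- 1) * (h * rat_of_xs (xspderiv i ?q))) * (rat_of_xs 1 / ?F ^ k)"
    using F by (simp add: field_simps)
  also have "\<dots> \<in> fs_module f"
    using assms by (intro fs_module_mult fs_module_add fs_module_of_xs)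
      (use fs_module_def in blast)+
  finally show ?thesis .
qed

lemma gen_act_fs_module:
  assumes "f \<noteq> 0" "h \<in> fs_module f"
  shows "gen_act f g h \<in> fs_module f"
proof (cases g)
  case (GX i)
  then show ?thesis
    using assms by (simp add: rat_of_x_def fs_module_mult fs_module_of_xs)
next
  case (GD i)
  have "rat_s * h * (1 / rat_of_x f) * rat_of_x (mpderiv i f) \<in> fs_module f"
    unfolding rat_s_def rat_of_x_def[of "mpderiv i f"]
    using assms by (intro fs_module_mult fs_module_of_xs fs_module_inverse)
  with GD show ?thesis
    using assms by (simp add: fs_module_add fs_module_pderiv)
qed

lemma ws_act_fs_module:
  assumes "f \<noteq> 0" "h \<in> fs_module f"
  shows "ws_act f P h \<in> fs_module f"
proof -
  have "foldr (gen_act f) l h \<in> fs_module f" for l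
    using assms by (induction l) (auto intro: gen_act_fs_module simp del: gen_act.simps)
  then have "free_act f p h \<in> fs_module f" for p
    unfolding free_act_def rat_of_x_def word_act_def
    using assms by (intro fs_module_sum fs_module_mult fs_module_of_xs)
  then have "weyl_act f a h \<in> fs_module f" for a
    by (induction a) (simp add: weyl_act.abs_eq)
  then show ?thesis
    unfolding ws_act_def rat_s_def rat_of_xs_power
    using assms by (intro fs_module_sum fs_module_mult fs_module_of_xs)
qed

definition ws_Ann ::
    "('n::linorder, 'k::field) mpoly \<Rightarrow> ('n, 'k) xsrat \<Rightarrow> ('n, 'k) weyl_s set"
  where "ws_Ann f u = {P. ws_act f P u = 0}"

section \<open>The Bernstein--Sato polynomial and $B$-operators\<close>

definition bernstein_functional ::
    "('n::linorder, 'k::field) mpoly \<Rightarrow> 'k poly \<Rightarrow> ('n, 'k) weyl_s \<Rightarrow> bool"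
  where "bernstein_functional f b P \<longleftrightarrow> ws_act f P (fpow_s1 f) = rat_of_s b * fpow_s"

definition bernstein_sato :: "('n::linorder, 'k::field) mpoly \<Rightarrow> 'k poly"
  where "bernstein_sato f = (THE b.
    lead_coeff b = 1 \<and> (\<exists>P. bernstein_functional f b P) \<and>
    (\<forall>b'. lead_coeff b' = 1 \<and> (\<exists>P. bernstein_functional f b' P) \<longrightarrow> degree b \<le> degree b'))"

definition is_B_operator :: "('n::linorder, 'k::field) mpoly \<Rightarrow> ('n, 'k) weyl_s \<Rightarrow> bool"
  where "is_B_operator f P \<longleftrightarrow> bernstein_functional f (bernstein_sato f) P"

section \<open>Left Groebner bases and normal forms in $D_n[s]$\<close>

text \<open>The exponent \<open>(\<alpha>, \<beta>, k)\<close> stands for the standard monomial $x^\alpha \partial^\beta s^k$.\<close>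

type_synonym 'n ws_exp = "('n \<Rightarrow>\<^sub>0 nat) \<times> ('n \<Rightarrow>\<^sub>0 nat) \<times> nat"

definition ws_monom :: "'n::{finite,linorder} ws_exp \<Rightarrow> ('n, 'k::field) weyl_s"
  where "ws_monom = (\<lambda>(\<alpha>, \<beta>, k). Poly_Mapping.single k (weyl_monom \<alpha> \<beta>))"

text \<open>
  By the Poincare--Birkhoff--Witt property the standard monomials form a $K$-basis of
  $D_n[s]$; \<open>ws_coeffs\<close> is the coordinate vector in this basis.
\<close>

definition ws_coeffs :: "('n::{finite,linorder}, 'k::field) weyl_s \<Rightarrow> ('n ws_exp \<Rightarrow>\<^sub>0 'k)"
  where "ws_coeffs P = (THE c. P = (\<Sum>e\<in>keys c. ws_const (lookup c e) * ws_monom e))"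

definition ws_support :: "('n::{finite,linorder}, 'k::field) weyl_s \<Rightarrow> 'n ws_exp set"
  where "ws_support P = keys (ws_coeffs P)"

definition monomial_well_ordering :: "'n ws_exp rel \<Rightarrow> bool"
  where "monomial_well_ordering r \<longleftrightarrow>
    well_order r \<and> (\<forall>u v w. (u, v) \<in> r \<longrightarrow> (u + w, v + w) \<in> r)"

definition lead_exp ::
    "'n::{finite,linorder} ws_exp rel \<Rightarrow> ('n, 'k::field) weyl_s \<Rightarrow> 'n ws_exp"
  where "lead_exp r P = (THE e. e \<in> ws_support P \<and> (\<forall>e'\<in>ws_support P. (e', e) \<in> r))"

definition exp_divides :: "'n ws_exp \<Rightarrow> 'n ws_exp \<Rightarrow> bool"
  where "exp_divides u v \<longleftrightarrow> (\<exists>d. v = d + u)"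

definition left_groebner_basis ::
    "'n::{finite,linorder} ws_exp rel \<Rightarrow> ('n, 'k::field) weyl_s set \<Rightarrow> ('n, 'k) weyl_s set \<Rightarrow> bool"
  where "left_groebner_basis r G L \<longleftrightarrow> finite G \<and> G \<subseteq> L \<and>
    (\<forall>P\<in>L - {0}. \<exists>g\<in>G - {0}. exp_divides (lead_exp r g) (lead_exp r P))"

text \<open>
  One step of left reduction: a left multiple of some \<open>g \<in> G\<close> by a term is subtracted, so that a
  monomial of \<open>P\<close> divisible by the leading monomial of \<open>g\<close> is cancelled.
\<close>

definition left_reduces ::
    "'n::{finite,linorder} ws_exp rel \<Rightarrow> ('n, 'k::field) weyl_s set
      \<Rightarrow> ('n, 'k) weyl_s \<Rightarrow> ('n, 'k) weyl_s \<Rightarrow> bool"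
  where "left_reduces r G P Q \<longleftrightarrow> (\<exists>g\<in>G - {0}. \<exists>d c.
    d + lead_exp r g \<in> ws_support P \<and>
    Q = P - ws_const c * ws_monom d * g \<and>
    d + lead_exp r g \<notin> ws_support Q)"

definition is_left_normal_form ::
    "'n::{finite,linorder} ws_exp rel \<Rightarrow> ('n, 'k::field) weyl_s set
      \<Rightarrow> ('n, 'k) weyl_s \<Rightarrow> ('n, 'k) weyl_s \<Rightarrow> bool"
  where "is_left_normal_form r G a P \<longleftrightarrow> (left_reduces r G)\<^sup>*\<^sup>* a P \<and>
    (\<forall>g\<in>G - {0}. \<forall>e\<in>ws_support P. \<not> exp_divides (lead_exp r g) e)"

end

theory Submission
  imports Defs
begin

text \<open>
  Reducing by elements of $\mathrm{Ann}(f^{s+1})$ does not change the action on $f^{s+1}$, so $P$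
  acts on $f^{s+1}$ like $a$ does. As $f^{s+1} = f \bullet f^s$ and the $h_i$ annihilate $f^s$,
  the identity $b_f = a f + \sum_i b_i h_i$ gives $a \bullet f^{s+1} = b_f f^s$.
\<close>

lemma weyl_act_0 [simp]: "weyl_act f 0 h = 0"
  by transfer simp

lemma weyl_act_1 [simp]: "weyl_act f 1 h = h"
  by transfer (simp add: free_act_1)

lemma weyl_act_add: "weyl_act f (p + q) h = weyl_act f p h + weyl_act f q h"
  by transfer (simp add: free_act_add)

lemma weyl_act_mult: "weyl_act f (p * q) h = weyl_act f p (weyl_act f q h)"
  by transfer (simp add: free_act_mult)

lemma weyl_act_right_0 [simp]: "weyl_act f p 0 = 0"
  by transfer simp

lemma weyl_act_right_add: "weyl_act f p (h + h') = weyl_act f p h + weyl_act f p h'"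
  by transfer (simp add: free_act_right_add)

lemma weyl_act_x: "weyl_act f (weyl_x i) h = rat_of_x (mvar i) * h"
  by transfer (simp add: free_act_gen)

lemma weyl_act_const: "weyl_act f (weyl_const c) h = rat_c c * h"
  by transfer (simp add: free_act_single word_act_def zero_free_monoid_def)

text \<open>Every derivation treats s as a constant (\<open>rat_pderiv_s\<close>), and the rest of
  the action is multiplication in the commutative field K(x,s). This mirrors the centrality of s in
  D_n[s]; the multiplicativity of \<open>ws_act\<close> rests on it.\<close>

lemma gen_act_s: "gen_act f g (rat_s * h) = rat_s * gen_act f g h"
  by (cases g) (simp_all add: rat_pderiv_mult distrib_left mult.left_commute)

lemma free_act_s: "free_act f p (rat_s * h) = rat_s * free_act f p h"
proof -
  have "foldr (gen_act f) l (rat_s * h) = rat_s * foldr (gen_act f) l h" for l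
    by (induction l) (simp_all add: gen_act_s del: gen_act.simps)
  then show ?thesis
    by (simp add: free_act_def word_act_def sum_distrib_left mult.left_commute)
qed

lemma weyl_act_s: "weyl_act f p (rat_s * h) = rat_s * weyl_act f p h"
  by transfer (rule free_act_s)

lemma weyl_act_s_power: "weyl_act f p (rat_s ^ k * h) = rat_s ^ k * weyl_act f p h"
  by (induction k) (simp_all add: weyl_act_s mult.assoc)

lemma ws_act_0 [simp]: "ws_act f 0 h = 0"
  by (simp add: ws_act_def)

lemma ws_act_add: "ws_act f (P + Q) h = ws_act f P h + ws_act f Q h"
  unfolding ws_act_def by (rule keys_sum_add) (simp_all add: weyl_act_add distrib_left)

lemma ws_act_diff: "ws_act f (P - Q) h = ws_act f P h - ws_act f Q h"
  using ws_act_add[of f "P - Q" Q h] by simp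

lemma ws_act_sum: "ws_act f (sum g A) h = (\<Sum>i\<in>A. ws_act f (g i) h)"
  by (induction A rule: infinite_finite_induct) (simp_all add: ws_act_add)

lemma ws_act_single:
  "ws_act f (Poly_Mapping.single k p) h = rat_s ^ k * weyl_act f p h"
  by (cases "p = 0") (simp_all add: ws_act_def)

lemma ws_act_right_0 [simp]: "ws_act f P 0 = 0"
  by (simp add: ws_act_def)

lemma ws_act_right_add: "ws_act f P (h + h') = ws_act f P h + ws_act f P h'"
  by (simp add: ws_act_def weyl_act_right_add distrib_left sum.distrib)

text \<open>Both sides are additive in P and in Q, so it suffices to compare terms p s^k and q s^l.
  There the power s^l produced by Q is moved past p by \<open>weyl_act_s_power\<close>.\<close>

lemma ws_act_mult: "ws_act f (P * Q) h = ws_act f P (ws_act f Q h)"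
proof (induction P rule: poly_mapping_add_induct)
  case (single k p)
  show ?case
    by (induction Q rule: poly_mapping_add_induct)
      (simp_all add: distrib_left ws_act_add ws_act_right_add mult_single ws_act_single
        weyl_act_mult weyl_act_s_power power_add mult.assoc)
qed (simp_all add: distrib_right ws_act_add)

lemma weyl_act_x_power: "weyl_act f (weyl_x i ^ k) h = rat_of_x (mvar i ^ k) * h"
  by (induction k) (simp_all add: weyl_act_mult weyl_act_x rat_of_x_mult mult.assoc)

lemma mvar_power:
  "mvar i ^ k = (Poly_Mapping.single (Poly_Mapping.single i k) 1 :: ('n, 'k::comm_ring_1) mpoly)"
  by (induction k) (simp_all add: mvar_def mult_single flip: single_add)

lemma prod_mvar_power:
  "finite A \<Longrightarrow> (\<Prod>i\<in>A. mvar i ^ e i)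
    = (Poly_Mapping.single (\<Sum>i\<in>A. Poly_Mapping.single i (e i)) 1 :: ('n, 'k::comm_ring_1) mpoly)"
  by (induction A rule: finite_induct) (simp_all add: mvar_power mult_single)

lemma weyl_act_monom:
  fixes f :: "('n::{finite,linorder}, 'k::field) mpoly"
  shows "weyl_act f (weyl_monom m 0) h = rat_of_x (Poly_Mapping.single m 1) * h"
proof -
  \<comment> \<open>Stated for an arbitrary list, so that induction can peel off one variable at a
    time.\<close>
  have "weyl_act f (prod_list (map (\<lambda>i. weyl_x i ^ lookup m i) l)) h
      = rat_of_x (prod_list (map (\<lambda>i. mvar i ^ lookup m i) l)) * h" for l
    by (induction l) (simp_all add: weyl_act_mult weyl_act_x_power rat_of_x_mult mult.assoc)
  \<comment> \<open>In K[x] the order of the factors is irrelevant, so the ordered product becomes a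
    product over the set of variables, to which \<open>prod_mvar_power\<close> applies.\<close>
  moreover have "prod_list (map (\<lambda>i. mvar i ^ lookup m i) (sorted_list_of_set UNIV))
      = (\<Prod>i\<in>UNIV. mvar i ^ lookup m i :: ('n, 'k) mpoly)"
    by (subst prod.distinct_set_conv_list[symmetric]) simp_all
  moreover have "(\<Sum>i\<in>UNIV. Poly_Mapping.single i (lookup m i)) = m"
    by (rule poly_mapping_eqI) (simp add: lookup_sum lookup_single when_def)
  moreover have "prod_list (map (\<lambda>i. weyl_d i ^ lookup 0 i) l) = (1 :: ('n, 'k) weyl)" for l
    by (induction l) simp_all
  ultimately show ?thesis
    by (simp add: weyl_monom_def prod_mvar_power)
qed

lemma rat_of_x_sum: "rat_of_x (sum g A) = (\<Sum>i\<in>A. rat_of_x (g i))"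
  by (induction A rule: infinite_finite_induct) (simp_all add: rat_of_x_add)

text \<open>Taking h to be \<open>fpow_s\<close>, the operator f sends f^s to f^{s+1}, which is how
  the factor f in the lift identity produces \<open>fpow_s1 f\<close>.\<close>

lemma ws_act_of_x: "ws_act f (ws_of_x p) h = rat_of_x p * h"
proof -
  have "ws_act f (ws_of_x p) h
      = (\<Sum>m\<in>keys p. rat_of_x (Poly_Mapping.single m (lookup p m))) * h"
    by (simp add: ws_of_x_def ws_act_sum ws_act_single weyl_act_mult weyl_act_const
        weyl_act_monom sum_distrib_right mconst_def mult_single
        flip: mult.assoc rat_of_x_mult)
  then show ?thesis
    by (simp add: poly_mapping_sum_single flip: rat_of_x_sum)
qed

lemma rat_of_xs_sum: "rat_of_xs (sum g A) = (\<Sum>i\<in>A. rat_of_xs (g i))"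
  by (induction A rule: infinite_finite_induct) (simp_all add: rat_of_xs_add)

lemma rat_s_power_times_x: "rat_s ^ k * rat_of_x p = rat_of_xs (monom p k)"
  by (simp add: rat_s_def rat_of_x_def rat_of_xs_power monom_altdef flip: rat_of_xs_mult)

lemma ws_act_of_s:
  fixes f :: "('n::linorder, 'k::field) mpoly"
  shows "ws_act f (ws_of_s b) h = rat_of_s b * h"
proof -
  \<comment> \<open>Both sides have the same coefficients: above the degree of b those of b vanish,
    and \<open>mconst\<close> sends 0 to 0.\<close>
  have "(map_poly mconst b :: ('n, 'k) xspoly) = (\<Sum>k\<le>degree b. monom (mconst (coeff b k)) k)"
    by (rule poly_eqI) (auto simp: coeff_map_poly coeff_sum coeff_eq_0)
  then show ?thesis
    by (simp add: ws_of_s_def ws_act_sum ws_act_single weyl_act_const rat_of_s_def rat_of_xs_sum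
        rat_s_power_times_x sum_distrib_right flip: mult.assoc)
qed

text \<open>A reduction step subtracts a left multiple of some g in G. Since g kills u, so does that
  multiple, by \<open>ws_act_mult\<close>.\<close>

lemma left_reduces_ws_act:
  assumes "G \<subseteq> ws_Ann f u" "left_reduces r G P Q"
  shows "ws_act f Q u = ws_act f P u"
  using assms by (auto simp: left_reduces_def ws_Ann_def ws_act_diff ws_act_mult)

lemma left_reduces_rtranclp_ws_act:
  assumes "(left_reduces r G)\<^sup>*\<^sup>* P Q" "G \<subseteq> ws_Ann f u"
  shows "ws_act f Q u = ws_act f P u"
  using assms by (induction rule: rtranclp_induct) (auto dest: left_reduces_ws_act)

theorem lemma7p2:
  fixes f :: "('n::{finite,linorder}, 'k::field_char_0) mpoly"
    and m :: nat
    and h b :: "nat \<Rightarrow> ('n, 'k) weyl_s"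
    and a P :: "('n, 'k) weyl_s"
    and r :: "'n ws_exp rel"
    and G :: "('n, 'k) weyl_s set"
  assumes nonconst: "\<nexists>c. f = mconst c"
    and generators: "is_left_ideal hull (h ` {1..m}) = ws_Ann f fpow_s"
    and lift: "ws_of_s (bernstein_sato f) = a * ws_of_x f + (\<Sum>i = 1..m. b i * h i)"
    and ordering: "monomial_well_ordering r"
    and groebner: "left_groebner_basis r G (ws_Ann f (fpow_s1 f))"
    and normal_form: "is_left_normal_form r G a P"
  shows "is_B_operator f P"
proof -
  \<comment> \<open>The generators lie in the left ideal that they generate, which is the
    annihilator of f^s.\<close>
  have h: "ws_act f (h i) fpow_s = 0" if "i \<in> {1..m}" for i
    using that hull_subset[of "h ` {1..m}" is_left_ideal] unfolding generators
    unfolding ws_Ann_def by blast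
  have "ws_act f P (fpow_s1 f) = ws_act f a (fpow_s1 f)"
    using normal_form groebner left_reduces_rtranclp_ws_act
    unfolding is_left_normal_form_def left_groebner_basis_def by blast
  \<comment> \<open>Read from right to left: each summand b_i h_i kills f^s, and a f acts on f^s as
    a acts on f^{s+1}.\<close>
  also have "\<dots> = ws_act f (a * ws_of_x f + (\<Sum>i = 1..m. b i * h i)) fpow_s"
    by (simp add: ws_act_add ws_act_sum ws_act_mult ws_act_of_x h fpow_s1_def)
  also have "\<dots> = rat_of_s (bernstein_sato f) * fpow_s"
    unfolding lift[symmetric] by (rule ws_act_of_s)
  finally show ?thesis
    by (simp add: is_B_operator_def bernstein_functional_def)
qed

end
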